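(* Let $r\ge 2$ and let $H$ be a connected $r$-uniform hypergraph on $n$ vertices with spectral radius $\rho>\sqrt[r]{4}$ and principal eigenvector $x$. Let $x_{\max}$ and $x_{\min}$ be the maximum and minimum entries of $x$, and let $\ell$ be the shortest distance between a vertex having $x_{\min}$ and a vertex having $x_{\max}$ as their $x$ components, i.e. $\ell=\min\{d(u,v): x_u=x_{\min},\ x_v=x_{\max}\}$. Let $\sigma=\frac12\left(\sqrt{\rho^r}+\sqrt{\rho^r-4}\right)$ and let $\gamma(H)=x_{\max}/x_{\min}$. Then $$\gamma(H)\le\left(\frac{\sigma^{\ell+1}-\sigma^{-(\ell+1)}}{\sigma-\sigma^{-1}}\right)^{\frac{2}{r}}.$$
   Context: A hypergraph $H=(V(H),E(H))$ on $n$ vertices has vertex set $V(H)=[n]=\{1,\dots,n\}$ (after labelling) and a set $E(H)$ of edges, which are subsets of $V(H)$; it is $r$-uniform if every edge contains exactly $r$ vertices. A path is an alternating sequence $v_1e_1v_2e_2\cdots v_\ell e_\ell v_{\ell+1}$ with $v_i,v_{i+1}\in e_i$ for $1\le i\le \ell$, all vertices and all edges in it being distinct; its length is the number $\ell$ of its edges. $H$ is connected if any two vertices are joined by a path, and the distance $d(u,v)$ is the length of a shortest path connecting $u$ and $v$ (with $d(u,u)=0$). The adjacency tensor $\mathcal{A}(H)$ is the order $r$, dimension $n$ tensor whose $(i_1i_2\cdots i_r)$-entry is $\frac{1}{(r-1)!}$ if $\{i_1,\dots,i_r\}\in E(H)$ and $0$ otherwise. For an order $r$ dimension $n$ tensor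 $\mathcal{A}=(a_{i_1\cdots i_r})$ and $x\in\mathbb{C}^n$, $\mathcal{A}x$ is the vector in $\mathbb{C}^n$ with $(\mathcal{A}x)_i=\sum_{i_2,\dots,i_r=1}^n a_{ii_2\cdots i_r}x_{i_2}\cdots x_{i_r}$. A number $\lambda\in\mathbb{C}$ is an eigenvalue of $\mathcal{A}$ with eigenvector $x\neq 0$ if $(\mathcal{A}x)_i=\lambda x_i^{r-1}$ for all $i$. The spectral radius $\rho(H)$ is the maximum modulus of the eigenvalues of $\mathcal{A}(H)$. For connected $H$, the principal eigenvector of $H$ is the unique eigenvector $x$ of $\mathcal{A}(H)$ corresponding to $\rho(H)$ with all entries positive and $\|x\|_r=\left(\sum_i x_i^r\right)^{1/r}=1$. The quantity $\gamma(H)$ is called the principal ratio of $H$. *)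

theory Defs
  imports "HOL-Analysis.Analysis"
begin

text \<open>
  A hypergraph on \<open>n\<close> vertices is given by its edge set \<open>E :: 'n set set\<close>; the vertex set is
  the whole finite type \<open>'n\<close>, so \<open>n = CARD('n)\<close>.
\<close>

definition uniform_hypergraph :: "nat \<Rightarrow> 'n::finite set set \<Rightarrow> bool" where
  "uniform_hypergraph r E \<longleftrightarrow> (\<forall>e\<in>E. card e = r)"

text \<open>
  The path \<open>v\<^sub>1 e\<^sub>1 v\<^sub>2 \<dots> v\<^sub>l e\<^sub>l v\<^sub>l\<^sub>+\<^sub>1\<close> is stored as its list of vertices and its list of
  edges. A single vertex is a path of length 0, so every vertex has distance 0 from itself.
\<close>

definition hyperpath :: "'n::finite set set \<Rightarrow> 'n list \<Rightarrow> 'n set list \<Rightarrow> bool" where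
  "hyperpath E vs es \<longleftrightarrow>
     length vs = length es + 1 \<and> distinct vs \<and> distinct es \<and> set es \<subseteq> E \<and>
     (\<forall>i<length es. vs ! i \<in> es ! i \<and> vs ! (i + 1) \<in> es ! i)"

definition hyperpath_between ::
    "'n::finite set set \<Rightarrow> 'n \<Rightarrow> 'n \<Rightarrow> 'n list \<Rightarrow> 'n set list \<Rightarrow> bool" where
  "hyperpath_between E u v vs es \<longleftrightarrow> hyperpath E vs es \<and> hd vs = u \<and> last vs = v"

definition hypergraph_connected :: "'n::finite set set \<Rightarrow> bool" where
  "hypergraph_connected E \<longleftrightarrow> (\<forall>u v. \<exists>vs es. hyperpath_between E u v vs es)"

definition hypergraph_dist :: "'n::finite set set \<Rightarrow> 'n \<Rightarrow> 'n \<Rightarrow> nat" where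
  "hypergraph_dist E u v = (LEAST l. \<exists>vs es. hyperpath_between E u v vs es \<and> length es = l)"

text \<open>
  A tensor of order \<open>r\<close> and dimension \<open>CARD('n)\<close> is a function on index lists, of which only the
  values at lists of length \<open>r\<close> matter.
\<close>

type_synonym 'n tensor = "'n list \<Rightarrow> complex"

definition adjacency_tensor :: "nat \<Rightarrow> 'n::finite set set \<Rightarrow> 'n tensor" where
  "adjacency_tensor r E = (\<lambda>is. if set is \<in> E then 1 / fact (r - 1) else 0)"

definition tensor_apply :: "nat \<Rightarrow> 'n::finite tensor \<Rightarrow> complex ^ 'n \<Rightarrow> complex ^ 'n" where
  "tensor_apply r A x = (\<chi> i. \<Sum>js | length js = r - 1. A (i # js) * (\<Prod>j\<leftarrow>js. x $ j))"

definition tensor_eigenvector ::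
    "nat \<Rightarrow> 'n::finite tensor \<Rightarrow> complex \<Rightarrow> complex ^ 'n \<Rightarrow> bool" where
  "tensor_eigenvector r A l x \<longleftrightarrow>
     x \<noteq> 0 \<and> (\<forall>i. tensor_apply r A x $ i = l * (x $ i) ^ (r - 1))"

definition tensor_eigenvalue :: "nat \<Rightarrow> 'n::finite tensor \<Rightarrow> complex \<Rightarrow> bool" where
  "tensor_eigenvalue r A l \<longleftrightarrow> (\<exists>x. tensor_eigenvector r A l x)"

text \<open>
  \<open>GREATEST\<close> rather than \<open>Max\<close>, because the latter is specified only for finite sets and would
  require the finiteness of the spectrum of a tensor.
\<close>

definition hypergraph_spectral_radius :: "nat \<Rightarrow> 'n::finite set set \<Rightarrow> real" where
  "hypergraph_spectral_radius r E =
     (GREATEST m. \<exists>l. tensor_eigenvalue r (adjacency_tensor r E) l \<and> m = cmod l)"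

text \<open>
  For a connected uniform hypergraph there is exactly one such vector (Perron--Frobenius).
\<close>

definition principal_eigenvector :: "nat \<Rightarrow> 'n::finite set set \<Rightarrow> real ^ 'n \<Rightarrow> bool" where
  "principal_eigenvector r E x \<longleftrightarrow>
     tensor_eigenvector r (adjacency_tensor r E)
       (complex_of_real (hypergraph_spectral_radius r E)) (\<chi> i. complex_of_real (x $ i)) \<and>
     (\<forall>i. x $ i > 0) \<and>
     root r (\<Sum>i\<in>UNIV. (x $ i) ^ r) = 1"

end

theory Submission
  imports Defs "HOL-Combinatorics.Multiset_Permutations"
begin

text \<open>
  For an edge \<open>e\<close> let \<open>x\<^sup>e\<close> be the product of the entries of \<open>x\<close> over \<open>e\<close>. After multiplication
  by \<open>x\<^sub>i\<close> the eigenvector equation reads \<open>\<rho> x\<^sub>i\<^sup>r = \<Sum>\<^bsub>e\<ni>i\<^esub> x\<^sup>e\<close>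
  (\<open>eigenvector_edge_sum\<close>). In particular \<open>x\<^sup>e \<le> \<rho> x\<^sub>i\<^sup>r\<close> for every vertex \<open>i\<close> of \<open>e\<close>; using this
  for all vertices of \<open>e\<close> except two chosen ones, \<open>a\<close> and \<open>b\<close>, bounds the weight of the edge from
  below by \<open>x\<^sub>a\<close> and \<open>x\<^sub>b\<close> alone: with \<open>s\<^sub>i = \<surd>(x\<^sub>i\<^sup>r)\<close> one gets
  \<open>s\<^sub>a s\<^sub>b \<le> (\<surd>\<rho>)\<^bsup>r-2\<^esup> x\<^sup>e\<close> (\<open>edge_weight_bound\<close>).

  Along a path from a minimal to a maximal entry, each inner vertex lies on two distinct edges of
  the path, so the two facts combine to \<open>s\<^bsub>i-1\<^esub> + s\<^bsub>i+1\<^esub> \<le> \<surd>(\<rho>\<^sup>r) s\<^sub>i\<close>, exactly as if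
  the hypergraph were a graph with spectral radius \<open>\<surd>(\<rho>\<^sup>r) = \<sigma> + \<sigma>\<^sup>-\<^sup>1\<close>. A sequence with this property
  grows at most as fast as the extremal solution
  \<open>(\<sigma>\<^bsup>k+1\<^esup> - \<sigma>\<^bsup>-(k+1)\<^esup>) / (\<sigma> - \<sigma>\<^sup>-\<^sup>1)\<close>
  of the corresponding recurrence (\<open>subrecurrence_growth\<close>), and the bound on
  \<open>s\<^sub>l / s\<^sub>0 = \<surd>(\<gamma>\<^sup>r)\<close> is the claim.
\<close>

section \<open>The eigenvector equation as a sum over edges\<close>

text \<open>
  A list of length \<open>r - 1\<close> that covers an \<open>r\<close>-set together with \<open>i\<close> has no room for repetitions
  or for \<open>i\<close> itself. There are thus \<open>(r - 1)!\<close> of them, which the factor \<open>1 / (r - 1)!\<close> in the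
  adjacency tensor compensates.
\<close>

lemma completing_lists_eq_permutations:
  assumes "finite e" "card e = r" "i \<in> e"
  shows "{js. length js = r - 1 \<and> set (i # js) = e} = permutations_of_set (e - {i})"
proof (intro equalityI subsetI)
  fix js assume "js \<in> {js. length js = r - 1 \<and> set (i # js) = e}"
  then have len: "length js = r - 1" and e: "insert i (set js) = e" by auto
  have card: "card (e - {i}) = r - 1" using assms by simp
  have "e - {i} \<subseteq> set js" using e by auto
  moreover have "card (set js) \<le> card (e - {i})"
    unfolding card using len card_length[of js] by simp
  ultimately have js: "e - {i} = set js" using card_seteq[OF finite_set] by blast
  moreover have "distinct js" using len card unfolding js by (simp add: card_distinct)
  ultimately show "js \<in> permutations_of_set (e - {i})" by (simp add: permutations_of_set_def)
next
  fix js assume "js \<in> permutations_of_set (e - {i})"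
  then have "set js = e - {i}" "distinct js" by (auto simp: permutations_of_set_def)
  with assms show "js \<in> {js. length js = r - 1 \<and> set (i # js) = e}"
    using distinct_card[of js] by auto
qed

lemma sum_completing_lists:
  fixes z :: "'n::finite \<Rightarrow> complex"
  assumes "card e = r" "i \<in> e"
  shows "(\<Sum>js | length js = r - 1 \<and> set (i # js) = e. \<Prod>j\<leftarrow>js. z j)
           = fact (r - 1) * (\<Prod>j\<in>e - {i}. z j)"
proof -
  have "(\<Sum>js\<in>permutations_of_set (e - {i}). \<Prod>j\<leftarrow>js. z j)
          = (\<Sum>js\<in>permutations_of_set (e - {i}). \<Prod>j\<in>e - {i}. z j)"
    by (intro sum.cong refl) (auto simp: permutations_of_set_def prod.distinct_set_conv_list[symmetric])
  then show ?thesis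
    using assms completing_lists_eq_permutations[OF finite assms] by simp
qed

lemma adjacency_tensor_apply:
  fixes z :: "complex ^ 'n::finite"
  assumes "uniform_hypergraph r E"
  shows "tensor_apply r (adjacency_tensor r E) z $ i = (\<Sum>e | e \<in> E \<and> i \<in> e. \<Prod>j\<in>e - {i}. z $ j)"
proof -
  let ?L = "{js :: 'n list. length js = r - 1}"
  let ?c = "1 / fact (r - 1) :: complex"
  have fin: "finite ?L" using finite_lists_length_eq[OF finite[of UNIV], of "r - 1"] by simp
  have "tensor_apply r (adjacency_tensor r E) z $ i
          = (\<Sum>js\<in>?L. if set (i # js) \<in> E then ?c * (\<Prod>j\<leftarrow>js. z $ j) else 0)"
    by (auto simp: tensor_apply_def adjacency_tensor_def intro!: sum.cong)
  also have "\<dots> = (\<Sum>js\<in>{js\<in>?L. set (i # js) \<in> E}. ?c * (\<Prod>j\<leftarrow>js. z $ j))"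
    using fin by (rule sum.inter_filter[symmetric])
  also have "\<dots> = (\<Sum>e | e \<in> E \<and> i \<in> e. \<Sum>js | js \<in> {js\<in>?L. set (i # js) \<in> E} \<and> set (i # js) = e.
                    ?c * (\<Prod>j\<leftarrow>js. z $ j))"
    by (rule sum.group[symmetric]) (use fin in auto)
  also have "\<dots> = (\<Sum>e | e \<in> E \<and> i \<in> e. \<Prod>j\<in>e - {i}. z $ j)"
  proof (intro sum.cong refl)
    fix e assume e: "e \<in> {e. e \<in> E \<and> i \<in> e}"
    then have "{js. js \<in> {js\<in>?L. set (i # js) \<in> E} \<and> set (i # js) = e}
                 = {js. length js = r - 1 \<and> set (i # js) = e}" by auto
    moreover have "card e = r" using assms e by (auto simp: uniform_hypergraph_def)
    ultimately show "(\<Sum>js | js \<in> {js\<in>?L. set (i # js) \<in> E} \<and> set (i # js) = e.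
                       ?c * (\<Prod>j\<leftarrow>js. z $ j)) = (\<Prod>j\<in>e - {i}. z $ j)"
      using sum_completing_lists[of e r i "\<lambda>j. z $ j"] e by (simp only: sum_distrib_left[symmetric]) simp
  qed
  finally show ?thesis .
qed

lemma eigenvector_edge_sum:
  fixes x :: "real ^ 'n::finite"
  assumes "r \<ge> 1" "uniform_hypergraph r E"
    and "tensor_eigenvector r (adjacency_tensor r E) (complex_of_real \<rho>) (\<chi> i. complex_of_real (x $ i))"
  shows "\<rho> * (x $ i) ^ r = (\<Sum>e | e \<in> E \<and> i \<in> e. \<Prod>j\<in>e. x $ j)"
proof -
  have "complex_of_real (\<Sum>e | e \<in> E \<and> i \<in> e. \<Prod>j\<in>e - {i}. x $ j)
          = complex_of_real (\<rho> * (x $ i) ^ (r - 1))"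
    using assms(3) adjacency_tensor_apply[OF assms(2), of "\<chi> i. complex_of_real (x $ i)" i]
    by (simp add: tensor_eigenvector_def)
  then have "(\<Sum>e | e \<in> E \<and> i \<in> e. \<Prod>j\<in>e - {i}. x $ j) = \<rho> * (x $ i) ^ (r - 1)"
    by (simp only: of_real_eq_iff)
  then have "\<rho> * ((x $ i) ^ (r - 1) * x $ i) = (\<Sum>e | e \<in> E \<and> i \<in> e. x $ i * (\<Prod>j\<in>e - {i}. x $ j))"
    by (simp add: sum_distrib_left[symmetric] mult_ac)
  also have "\<dots> = (\<Sum>e | e \<in> E \<and> i \<in> e. \<Prod>j\<in>e. x $ j)"
    by (intro sum.cong refl) (auto simp: prod.remove[of _ i])
  also have "(x $ i) ^ (r - 1) * x $ i = (x $ i) ^ r"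
    using assms(1) by (metis One_nat_def Suc_le_eq power_minus_mult)
  finally show ?thesis .
qed

section \<open>The weight of an edge\<close>

text \<open>
  Raise the weight \<open>P\<close> of the edge to the power \<open>r\<close> and bound the \<open>r - 2\<close> factors \<open>x\<^sub>u\<^sup>r\<close> belonging
  to vertices \<open>u\<close> other than \<open>a\<close> and \<open>b\<close> from below by \<open>P / \<rho>\<close>. Then \<open>P\<^sup>2 \<rho>\<^bsup>r-2\<^esup>\<close> is at
  least \<open>x\<^sub>a\<^sup>r x\<^sub>b\<^sup>r\<close>; the assertion is the square root of this.
\<close>

lemma edge_weight_bound:
  fixes x :: "'n \<Rightarrow> real"
  assumes "finite e" "card e = r" "a \<in> e" "b \<in> e" "a \<noteq> b" "\<rho> > 0"
    and pos: "\<And>u. u \<in> e \<Longrightarrow> x u > 0"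
    and le: "\<And>u. u \<in> e \<Longrightarrow> (\<Prod>j\<in>e. x j) \<le> \<rho> * x u ^ r"
  shows "sqrt (x a ^ r) * sqrt (x b ^ r) \<le> sqrt \<rho> ^ (r - 2) * (\<Prod>j\<in>e. x j)"
proof -
  define P where "P = (\<Prod>j\<in>e. x j)"
  define R where "R = e - {a, b}"
  have P: "P > 0" unfolding P_def using pos by (intro prod_pos) auto
  have cR: "card R = r - 2" using assms(1-5) unfolding R_def by (simp add: card_Diff_subset)
  have "card {a, b} \<le> card e" using assms(1-5) by (intro card_mono) auto
  then have r: "r = 2 + (r - 2)" using assms(2,5) by simp
  have e: "e = insert a (insert b R)" using assms(3,4) unfolding R_def by auto
  have "P ^ r = (\<Prod>u\<in>e. x u ^ r)" unfolding P_def by (simp add: prod_power_distrib)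
  also have "\<dots> = x a ^ r * (x b ^ r * (\<Prod>u\<in>R. x u ^ r))"
    using assms(1,5) unfolding e by (subst prod.insert; (subst prod.insert)?) (auto simp: R_def)
  finally have split: "P ^ r = x a ^ r * (x b ^ r * (\<Prod>u\<in>R. x u ^ r))" .
  have "P ^ (r - 2) = (\<Prod>u\<in>R. P)" using cR by simp
  also have "\<dots> \<le> (\<Prod>u\<in>R. \<rho> * x u ^ r)"
    using P le by (intro prod_mono) (auto simp: P_def R_def)
  also have "\<dots> = \<rho> ^ (r - 2) * (\<Prod>u\<in>R. x u ^ r)" using cR by (simp add: prod.distrib)
  finally have "x a ^ r * x b ^ r * P ^ (r - 2) \<le> x a ^ r * x b ^ r * (\<rho> ^ (r - 2) * (\<Prod>u\<in>R. x u ^ r))"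
    using pos[OF assms(3)] pos[OF assms(4)] by (intro mult_left_mono) auto
  also have "\<dots> = \<rho> ^ (r - 2) * P ^ r" unfolding split by (simp add: mult_ac)
  also have "\<dots> = \<rho> ^ (r - 2) * P\<^sup>2 * P ^ (r - 2)" using r by (metis mult.assoc power_add)
  finally have "x a ^ r * x b ^ r \<le> \<rho> ^ (r - 2) * P\<^sup>2" using P by simp
  then have "sqrt (x a ^ r * x b ^ r) \<le> sqrt (\<rho> ^ (r - 2) * P\<^sup>2)" by simp
  then show ?thesis using P by (simp add: real_sqrt_mult real_sqrt_power P_def)
qed

section \<open>Growth along a path\<close>

text \<open>
  The numbers \<open>D k = \<sigma>\<^sup>k - \<sigma>\<^bsup>-k\<^esup>\<close> satisfy the recurrence with equality. For positive
  \<open>s\<close>, the hypothesis bounds \<open>s (k + 2) / s (k + 1)\<close> by \<open>\<sigma> + \<sigma>\<^sup>-\<^sup>1\<close> minus the reciprocal of the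
  preceding ratio, so the upper bound \<open>D (k + 2) / D (k + 1)\<close> on \<open>s (k + 1) / s k\<close> propagates along
  the sequence, and multiplying the ratios gives the claim. The proof carries this out with the
  denominators cleared.
\<close>

lemma subrecurrence_growth:
  fixes s :: "nat \<Rightarrow> real" and \<sigma> :: real
  defines "D \<equiv> \<lambda>k. \<sigma> ^ k - inverse \<sigma> ^ k"
  assumes "\<sigma> > 1"
    and start: "l > 0 \<Longrightarrow> s 1 \<le> (\<sigma> + inverse \<sigma>) * s 0"
    and step: "\<And>k. k + 2 \<le> l \<Longrightarrow> s k + s (k + 2) \<le> (\<sigma> + inverse \<sigma>) * s (k + 1)"
  shows "s l \<le> D (l + 1) / D 1 * s 0"
proof -
  have Dpos: "D (Suc k) > 0" for k
  proof -
    have "inverse \<sigma> ^ Suc k < 1"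
      using assms(2) by (intro power_Suc_less_one) (auto simp: inverse_less_1_iff)
    moreover have "1 < \<sigma> ^ Suc k" using assms(2) by (intro one_less_power) auto
    ultimately show ?thesis unfolding D_def by linarith
  qed
  have Drec: "(\<sigma> + inverse \<sigma>) * D (k + 1) = D k + D (k + 2)" for k
  proof -
    have "(a + b) * (p * a - q * b) = (p - q) + (p * a\<^sup>2 - q * b\<^sup>2)"
      if "a * b = 1" for a b p q :: real using that by algebra
    from this[of \<sigma> "inverse \<sigma>" "\<sigma> ^ k" "inverse \<sigma> ^ k"] show ?thesis
      using assms(2) by (simp add: D_def power_add power2_eq_square mult_ac)
  qed
  have ratio: "s (k + 1) * D (k + 1) \<le> s k * D (k + 2)" if "k + 1 \<le> l" for k
    using that
  proof (induction k)
    case 0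
    have "s 1 * D 1 \<le> ((\<sigma> + inverse \<sigma>) * s 0) * D 1"
      using start 0 Dpos[of 0] by (intro mult_right_mono) auto
    also have "\<dots> = s 0 * D 2" using Drec[of 0] by (simp add: D_def power2_eq_square mult_ac)
    finally show ?case by (simp add: numeral_2_eq_2)
  next
    case (Suc k)
    have "s (k + 2) * D (k + 2) \<le> ((\<sigma> + inverse \<sigma>) * s (k + 1) - s k) * D (k + 2)"
      using step[of k] Suc.prems Dpos[of "k + 1"] by (intro mult_right_mono) auto
    also have "\<dots> = (\<sigma> + inverse \<sigma>) * D (k + 2) * s (k + 1) - s k * D (k + 2)"
      by (simp add: algebra_simps)
    also have "\<dots> \<le> (\<sigma> + inverse \<sigma>) * D (k + 2) * s (k + 1) - s (k + 1) * D (k + 1)"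
      using Suc by simp
    also have "\<dots> = s (k + 1) * D (k + 3)"
      using Drec[of "k + 1"] by (simp add: algebra_simps eval_nat_numeral)
    finally show ?case by (simp add: eval_nat_numeral)
  qed
  have "s k * D 1 \<le> s 0 * D (k + 1)" if "k \<le> l" for k
    using that
  proof (induction k)
    case 0
    show ?case by simp
  next
    case (Suc k)
    have "(s (k + 1) * D 1) * D (k + 1) = (s (k + 1) * D (k + 1)) * D 1" by simp
    also have "\<dots> \<le> (s k * D (k + 2)) * D 1"
      using ratio[of k] Suc.prems Dpos[of 0] by (intro mult_right_mono) auto
    also have "\<dots> = (s k * D 1) * D (k + 2)" by simp
    also have "\<dots> \<le> (s 0 * D (k + 1)) * D (k + 2)"
      using Suc Dpos[of "k + 1"] by (intro mult_right_mono) auto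
    finally have "(s (k + 1) * D 1) * D (k + 1) \<le> (s 0 * D (k + 2)) * D (k + 1)"
      by (simp add: mult_ac)
    then show ?case using Dpos[of k] by simp
  qed
  from this[of l] show ?thesis using Dpos[of 0] by (simp add: field_simps)
qed

text \<open>
  At an inner vertex the two path edges are distinct terms of the edge sum, which is why their
  weights may be added; \<open>edge_weight_bound\<close> turns the weights into entries of \<open>x\<close> at the
  neighbours on the path.
\<close>

lemma hyperpath_subrecurrence:
  fixes x :: "'n::finite \<Rightarrow> real" and r :: nat
  defines "s \<equiv> \<lambda>v. sqrt (x v ^ r)"
  assumes "r \<ge> 2" "uniform_hypergraph r E" "\<rho> > 0" "\<And>v. x v > 0"
    and sum: "\<And>v. \<rho> * x v ^ r = (\<Sum>e | e \<in> E \<and> v \<in> e. \<Prod>j\<in>e. x j)"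
    and path: "hyperpath E vs es"
  shows "length es > 0 \<Longrightarrow> s (vs ! 1) \<le> sqrt (\<rho> ^ r) * s (vs ! 0)"
    and "k + 2 \<le> length es \<Longrightarrow> s (vs ! k) + s (vs ! (k + 2)) \<le> sqrt (\<rho> ^ r) * s (vs ! (k + 1))"
proof -
  define c where "c = sqrt \<rho> ^ (r - 2)"
  define w where "w = (\<lambda>e. \<Prod>j\<in>e. x j)"
  have c: "c > 0" unfolding c_def using assms(4) by simp
  have s: "s v > 0" for v unfolding s_def using assms(5) by simp
  have w: "w e > 0" for e unfolding w_def using assms(5) by (intro prod_pos) auto
  have rho: "\<rho> * c = sqrt (\<rho> ^ r)"
  proof -
    have "\<rho> = sqrt \<rho> ^ 2" using assms(4) by simp
    then have "\<rho> * c = sqrt \<rho> ^ (2 + (r - 2))" unfolding c_def by (metis power_add)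
    also have "2 + (r - 2) = r" using assms(2) by simp
    finally show ?thesis by (simp add: real_sqrt_power)
  qed
  have partial: "(\<Sum>e\<in>F. w e) \<le> \<rho> * x v ^ r" if "F \<subseteq> {e. e \<in> E \<and> v \<in> e}" for F v
    unfolding sum w_def[symmetric] using that w by (intro sum_mono2) (auto intro: less_imp_le)
  have weight: "s a * s b \<le> c * w e" if "e \<in> E" "a \<in> e" "b \<in> e" "a \<noteq> b" for e a b
    unfolding s_def c_def w_def
  proof (rule edge_weight_bound)
    show "(\<Prod>j\<in>e. x j) \<le> \<rho> * x u ^ r" if "u \<in> e" for u
      using partial[of "{e}" u] \<open>e \<in> E\<close> that by (simp add: w_def)
  qed (use that assms in \<open>auto simp: uniform_hypergraph_def\<close>)
  have sq: "c * (\<rho> * x v ^ r) = sqrt (\<rho> ^ r) * s v * s v" for v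
    using assms(5)[of v] unfolding rho[symmetric] by (simp add: s_def mult_ac)
  have len: "length vs = length es + 1" and dv: "distinct vs" and de: "distinct es"
    and E: "\<And>i. i < length es \<Longrightarrow> es ! i \<in> E"
    and inc: "\<And>i. i < length es \<Longrightarrow> vs ! i \<in> es ! i" "\<And>i. i < length es \<Longrightarrow> vs ! (i + 1) \<in> es ! i"
    using path by (auto simp: hyperpath_def)
  have edge: "s (vs ! i) * s (vs ! (i + 1)) \<le> c * w (es ! i)" if "i < length es" for i
    using that by (intro weight E inc) (auto simp: len nth_eq_iff_index_eq[OF dv])
  show "s (vs ! 1) \<le> sqrt (\<rho> ^ r) * s (vs ! 0)" if l: "length es > 0"
  proof -
    have "s (vs ! 0) * s (vs ! 1) \<le> c * w (es ! 0)" using edge[of 0] l by simp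
    also have "\<dots> \<le> c * (\<rho> * x (vs ! 0) ^ r)"
      using partial[of "{es ! 0}" "vs ! 0"] E[of 0] inc(1)[of 0] l c by (intro mult_left_mono) auto
    also have "\<dots> = sqrt (\<rho> ^ r) * s (vs ! 0) * s (vs ! 0)" by (rule sq)
    finally have "s (vs ! 1) * s (vs ! 0) \<le> (sqrt (\<rho> ^ r) * s (vs ! 0)) * s (vs ! 0)"
      by (simp add: mult_ac)
    then show ?thesis using s[of "vs ! 0"] by simp
  qed
  show "s (vs ! k) + s (vs ! (k + 2)) \<le> sqrt (\<rho> ^ r) * s (vs ! (k + 1))" if l: "k + 2 \<le> length es"
  proof -
    let ?v = "vs ! (k + 1)"
    have ne: "es ! k \<noteq> es ! (k + 1)" using l by (simp add: nth_eq_iff_index_eq[OF de])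
    have "s (vs ! k) * s ?v + s ?v * s (vs ! (k + 2)) \<le> c * w (es ! k) + c * w (es ! (k + 1))"
      using edge[of k] edge[of "k + 1"] l by (intro add_mono) auto
    also have "\<dots> = c * (\<Sum>e\<in>{es ! k, es ! (k + 1)}. w e)" using ne by (simp add: distrib_left)
    also have "\<dots> \<le> c * (\<rho> * x ?v ^ r)"
      using c l E inc(1)[of "k + 1"] inc(2)[of k] by (intro mult_left_mono partial) auto
    also have "\<dots> = sqrt (\<rho> ^ r) * s ?v * s ?v" by (rule sq)
    finally have "(s (vs ! k) + s (vs ! (k + 2))) * s ?v \<le> (sqrt (\<rho> ^ r) * s ?v) * s ?v"
      by (simp add: algebra_simps)
    then show ?thesis using s[of ?v] by simp
  qed
qed

section \<open>The bound on the principal ratio\<close>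

text \<open>\<open>\<sigma>\<close> is the larger root of \<open>\<sigma>\<^sup>2 - t \<sigma> + 1 = 0\<close>, where \<open>t = \<surd>q\<close>.\<close>

lemma sigma_root:
  fixes q :: real
  defines "\<sigma> \<equiv> 1 / 2 * (sqrt q + sqrt (q - 4))"
  assumes "q > 4"
  shows "\<sigma> > 1" "\<sigma> + inverse \<sigma> = sqrt q"
proof -
  have "sqrt q > 2" using assms(2) real_less_rsqrt[of 2 q] by simp
  moreover have "sqrt (q - 4) > 0" using assms(2) by simp
  ultimately have "2 + 0 < sqrt q + sqrt (q - 4)" by (rule add_strict_mono)
  then show gt: "\<sigma> > 1" unfolding \<sigma>_def by simp
  have "\<sigma> * (sqrt q - \<sigma>) = ((sqrt q)\<^sup>2 - (sqrt (q - 4))\<^sup>2) / 4"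
    unfolding \<sigma>_def by (simp add: field_simps power2_eq_square)
  also have "\<dots> = 1" using assms(2) by simp
  finally show "\<sigma> + inverse \<sigma> = sqrt q" using gt by (simp add: field_simps)
qed

lemma hypergraph_dist_attained:
  assumes "hypergraph_connected E"
  obtains vs es where "hyperpath_between E u v vs es" "length es = hypergraph_dist E u v"
proof -
  have "\<exists>l vs es. hyperpath_between E u v vs es \<and> length es = l"
    using assms unfolding hypergraph_connected_def by blast
  then have "\<exists>vs es. hyperpath_between E u v vs es \<and> length es = hypergraph_dist E u v"
    unfolding hypergraph_dist_def by (rule LeastI_ex)
  then show thesis using that by blast
qed

theorem corollary3p5:
  fixes r l :: nat
    and E :: "'n::finite set set"
    and x :: "real ^ 'n"
    and \<rho> \<sigma> \<gamma> xmax xmin :: real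
  assumes "r \<ge> 2"
    and "uniform_hypergraph r E"
    and "hypergraph_connected E"
    and "\<rho> = hypergraph_spectral_radius r E"
    and "\<rho> > root r 4"
    and "principal_eigenvector r E x"
    and "xmax = Max (range (\<lambda>i. x $ i))"
    and "xmin = Min (range (\<lambda>i. x $ i))"
    and "l = Min {hypergraph_dist E u v | u v. x $ u = xmin \<and> x $ v = xmax}"
    and "\<sigma> = 1 / 2 * (sqrt (\<rho> ^ r) + sqrt (\<rho> ^ r - 4))"
    and "\<gamma> = xmax / xmin"
  shows "\<gamma> \<le> ((\<sigma> ^ (l + 1) - \<sigma> powi (- int (l + 1))) / (\<sigma> - inverse \<sigma>)) powr (2 / real r)"
proof -
  have pos: "\<And>i. x $ i > 0" using assms(6) by (simp add: principal_eigenvector_def)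
  have rho_pos: "\<rho> > 0" using assms(1,5) real_root_gt_zero[of r 4] by linarith
  have "4 = root r 4 ^ r" using assms(1) by simp
  also have "\<dots> < \<rho> ^ r" using assms(1,5) by (intro power_strict_mono) auto
  finally have "\<rho> ^ r > 4" .
  note \<sigma> = sigma_root[OF this, folded assms(10)]

  let ?S = "{hypergraph_dist E u v | u v. x $ u = xmin \<and> x $ v = xmax}"
  have "xmin \<in> range (\<lambda>i. x $ i)" "xmax \<in> range (\<lambda>i. x $ i)" unfolding assms(7,8) by simp_all
  then have "?S \<noteq> {}" by auto
  moreover have "finite ?S"
    by (rule finite_subset[of _ "range (\<lambda>(u, v). hypergraph_dist E u v)"]) auto
  ultimately have "l \<in> ?S" unfolding assms(9) by (intro Min_in)
  then obtain u v where uv: "x $ u = xmin" "x $ v = xmax" "l = hypergraph_dist E u v" by blast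
  obtain vs es where p: "hyperpath_between E u v vs es" "length es = l"
    using hypergraph_dist_attained[OF assms(3)] uv(3) by metis
  then have path: "hyperpath E vs es" and len: "length vs = l + 1"
    by (auto simp: hyperpath_between_def hyperpath_def)
  from len have "vs \<noteq> []" by auto
  with p len have ends: "vs ! 0 = u" "vs ! l = v"
    by (auto simp: hyperpath_between_def hd_conv_nth last_conv_nth)

  define s where "s = (\<lambda>k. sqrt ((x $ (vs ! k)) ^ r))"
  define U where "U = (\<sigma> ^ (l + 1) - inverse \<sigma> ^ (l + 1)) / (\<sigma> - inverse \<sigma>)"
  have sum: "\<rho> * (x $ i) ^ r = (\<Sum>e | e \<in> E \<and> i \<in> e. \<Prod>j\<in>e. x $ j)" for i
    by (rule eigenvector_edge_sum)
       (use assms(1,2,4,6) in \<open>auto simp: principal_eigenvector_def\<close>)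
  note rec = hyperpath_subrecurrence[OF assms(1,2) rho_pos pos sum path]
  have "s l \<le> (\<sigma> ^ (l + 1) - inverse \<sigma> ^ (l + 1)) / (\<sigma> ^ 1 - inverse \<sigma> ^ 1) * s 0"
    by (rule subrecurrence_growth[OF \<sigma>(1)]) (use rec p(2) in \<open>simp_all add: \<sigma>(2) s_def\<close>)
  then have "s l \<le> U * s 0" by (simp add: U_def)
  moreover have s0: "s 0 > 0" unfolding s_def using pos by simp
  ultimately have "s l / s 0 \<le> U" by (simp add: field_simps)
  moreover have "s l / s 0 = sqrt (\<gamma> ^ r)"
    by (simp add: s_def ends uv(1,2) assms(11) power_divide real_sqrt_divide)
  ultimately have "sqrt (\<gamma> ^ r) \<le> U" by simp
  have g: "\<gamma> > 0" unfolding assms(11) using pos uv by (metis divide_pos_pos)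
  have "sqrt (\<gamma> ^ r) = \<gamma> powr (real r / 2)"
    using g by (simp add: powr_half_sqrt[symmetric] powr_realpow[symmetric] powr_powr)
  then have "\<gamma> = sqrt (\<gamma> ^ r) powr (2 / real r)" using g assms(1) by (simp add: powr_powr)
  also have "\<dots> \<le> U powr (2 / real r)"
    using \<open>sqrt (\<gamma> ^ r) \<le> U\<close> g by (intro powr_mono2) auto
  also have "U = (\<sigma> ^ (l + 1) - \<sigma> powi (- int (l + 1))) / (\<sigma> - inverse \<sigma>)"
    unfolding U_def by (simp only: power_int_minus power_int_of_nat power_inverse)
  finally show ?thesis .
qed

end
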